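(* Let $m\ge1$, let $\{A(k)\}_{k\ge0}$ be an arbitrary chain of $m\times m$ stochastic matrices and let $\{P(k)\}_{k\ge0}$ be an arbitrary sequence of $m\times m$ permutation matrices. Let $\{B(k)\}$ be the rotational transformation of $\{A(k)\}$ by $\{P(k)\}$. Then the following hold. (a) The chain $\{B(k)\}$ is stochastic. Furthermore, $B(k:s)=P^T(k:0)A(k:s)P(s:0)$ for any $k>s\ge0$, where $P(0:0)=I$. (b) The chain $\{A(k)\}$ is ergodic if and only if the chain $\{B(k)\}$ is ergodic. (c) For any regular sequence $\{S(k)\}$ there exists a regular sequence $\{T(k)\}$ such that $B_{T(k+1),T(k)}(k)=A_{S(k+1),S(k)}(k)$ for all $k\ge0$. Also, for any regular sequence $\{T(k)\}$ there exists a regular sequence $\{S(k)\}$ such that $A_{S(k+1),S(k)}(k)=B_{T(k+1),T(k)}(k)$ for all $k\ge 0$. In particular, $F(\{A(k)\};\{S(k)\})=F(\{B(k)\};\{T(k)\})$ for such sequences, and hence $\{A(k)\}$ has the absolute infinite flow property if and only if $\{B(k)\}$ has the absolute infinite flow property. (d) For any $S\subset[m]$ and $k\ge0$, we have $A_{S(k+1),S(k)}(k)=B_S(k)$, where $S(k)=P(k:0)(S)$ is the image of $S$ under $\{P(k)\}$ at time $k$.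
   Context: $[m]=\{1,\dots,m\}$; $S\subset[m]$ denotes a proper subset, and $\bar S=[m]\setminus S$. A matrix is stochastic if its entries are nonnegative and each row sums to $1$; a stochastic chain is a sequence $\{A(k)\}_{k\ge0}$ of stochastic $m\times m$ matrices. A vector is stochastic if its entries are nonnegative and sum to $1$; $e$ is the all-ones column vector. For a sequence of matrices and $k>s\ge 0$, $A(k:s)=A(k-1)A(k-2)\cdots A(s)$ (similarly $B(k:s)$, $P(k:s)$), and $P(0:0)=I$; $P^T(k:0)$ denotes the transpose of $P(k:0)$. A stochastic chain $\{A(k)\}$ is ergodic if for every $s\ge0$ there is a stochastic vector $v(s)$ with $\lim_{k\to\infty}A(k:s)=e\,v(s)^T$. The rotational transformation of $\{A(k)\}$ by the permutation sequence $\{P(k)\}$ is the chain $\{B(k)\}$ given by $B(k)=P^T(k+1:0)A(k)P(k:0)$ for $k\ge0$. For a permutation matrix $P$ and $S\subset[m]$, $P(S)=\{i\in[m]\mid P_{ij}=1\text{ for some }j\in S\}$. For a matrix sequence $\{B(k)\}$ and $S\subset[m]$, $B_S(k)=\sum_{i\in S,\,j\in\bar S}(B_{ij}(k)+B_{ji}(k))$. A sequence $\{S(k)\}_{k\ge0}$ of sets $S(k)\subset[m]$ is regular if $|S(k)|=|S(0)|\neq 0$ for all $k\ge 0$. For sets $S(k)\subset[m]$ define $$A_{S(k+1),S(k)}(k)=\sum_{i\in S(k+1),\,j\in\bar S(k)}A_{ij}(k)+\sum_{i\in\bar S(k+1),\,j\in S(k)}A_{ij}(k),\qquad F(\{A(k)\};\{S(k)\})=\sum_{k=0}^\infty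 A_{S(k+1),S(k)}(k),$$ and analogously for $\{B(k)\}$. A stochastic chain $\{A(k)\}$ has the absolute infinite flow property if $F(\{A(k)\};\{S(k)\})=\infty$ for every regular sequence $\{S(k)\}$. *)

theory Defs
  imports "HOL-Analysis.Analysis"
begin

(* The index set [m] is the finite type 'm, so m = CARD('m) >= 1, the complement of S is - S,
   and "S is a proper subset" is S \<subset> UNIV (the empty set is allowed). *)

definition stochastic_vector :: "real^'m \<Rightarrow> bool" where
  "stochastic_vector v \<longleftrightarrow> (\<forall>i. 0 \<le> v $ i) \<and> (\<Sum>i\<in>UNIV. v $ i) = 1"

definition stochastic_matrix :: "real^'m^'m \<Rightarrow> bool" where
  "stochastic_matrix M \<longleftrightarrow> (\<forall>i j. 0 \<le> M $ i $ j) \<and> (\<forall>i. (\<Sum>j\<in>UNIV. M $ i $ j) = 1)"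

definition stochastic_chain :: "(nat \<Rightarrow> real^'m^'m) \<Rightarrow> bool" where
  "stochastic_chain A \<longleftrightarrow> (\<forall>k. stochastic_matrix (A k))"

definition permutation_matrix :: "real^'m^'m \<Rightarrow> bool" where
  "permutation_matrix Q \<longleftrightarrow>
     (\<forall>i j. Q $ i $ j = 0 \<or> Q $ i $ j = 1) \<and>
     (\<forall>i. \<exists>!j. Q $ i $ j = 1) \<and> (\<forall>j. \<exists>!i. Q $ i $ j = 1)"

text \<open>The backward product \<open>A(k:s) = A(k-1) \<cdots> A(s)\<close> for \<open>k > s\<close>; it is the identity
  for \<open>k \<le> s\<close>, which covers the convention \<open>P(0:0) = I\<close>.\<close>

primrec bprod :: "(nat \<Rightarrow> real^'m^'m) \<Rightarrow> nat \<Rightarrow> nat \<Rightarrow> real^'m^'m" where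
  "bprod A 0 s = mat 1"
| "bprod A (Suc k) s = (if s \<le> k then A k ** bprod A k s else mat 1)"

text \<open>The numeral \<open>1\<close> below is the all-ones vector \<open>e\<close>, so the limit is the
  matrix \<open>e v\<^sup>T\<close>.\<close>

definition ergodic :: "(nat \<Rightarrow> real^'m^'m) \<Rightarrow> bool" where
  "ergodic A \<longleftrightarrow> (\<forall>s. \<exists>v. stochastic_vector v \<and>
     (\<lambda>k. bprod A k s) \<longlonglongrightarrow> columnvector 1 ** (rowvector v :: real^'m^1))"

definition rotational_transformation :: "(nat \<Rightarrow> real^'m^'m) \<Rightarrow> (nat \<Rightarrow> real^'m^'m) \<Rightarrow> (nat \<Rightarrow> real^'m^'m)" where
  "rotational_transformation A P =
     (\<lambda>k. transpose (bprod P (k + 1) 0) ** A k ** bprod P k 0)"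

definition perm_image :: "real^'m^'m \<Rightarrow> 'm set \<Rightarrow> 'm set" where
  "perm_image Q S = {i. \<exists>j\<in>S. Q $ i $ j = 1}"

definition cut_flow :: "real^'m^'m \<Rightarrow> 'm set \<Rightarrow> real" where
  "cut_flow M S = (\<Sum>i\<in>S. \<Sum>j\<in>- S. M $ i $ j + M $ j $ i)"

text \<open>\<open>trans_flow (A k) (S (k + 1)) (S k)\<close> is \<open>A\<^bsub>S(k+1),S(k)\<^esub>(k)\<close>.\<close>

definition trans_flow :: "real^'m^'m \<Rightarrow> 'm set \<Rightarrow> 'm set \<Rightarrow> real" where
  "trans_flow M S' S =
     (\<Sum>i\<in>S'. \<Sum>j\<in>- S. M $ i $ j) + (\<Sum>i\<in>- S'. \<Sum>j\<in>S. M $ i $ j)"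

definition regular :: "(nat \<Rightarrow> 'm::finite set) \<Rightarrow> bool" where
  "regular S \<longleftrightarrow> (\<forall>k. S k \<subset> (UNIV :: 'm set)) \<and> (\<forall>k. card (S k) = card (S 0)) \<and> card (S 0) \<noteq> 0"

text \<open>For nonnegative chains the series always converges in the extended reals.\<close>

definition total_flow :: "(nat \<Rightarrow> real^'m^'m) \<Rightarrow> (nat \<Rightarrow> 'm set) \<Rightarrow> ereal" where
  "total_flow A S = (\<Sum>k. ereal (trans_flow (A k) (S (k + 1)) (S k)))"

definition absolute_infinite_flow :: "(nat \<Rightarrow> real^'m^'m) \<Rightarrow> bool" where
  "absolute_infinite_flow A \<longleftrightarrow> (\<forall>S. regular S \<longrightarrow> total_flow A S = \<infinity>)"

end

theory Submission
  imports Defs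
begin

text \<open>A permutation matrix is a bijection \<open>f\<close> of the index set in disguise, and multiplying by
  permutation matrices only renames rows and columns:
  \<open>Q\<^sub>f\<^sup>T M Q\<^sub>g\<close> has the entries \<open>M(f i, g j)\<close>. As \<open>P(k:0)\<close> is the permutation matrix of some
  bijection \<open>\<pi> k\<close>, the chain \<open>B\<close> has the entries \<open>A(k)(\<pi> (k+1) i, \<pi> k j)\<close>: the states at time \<open>k\<close>
  are relabelled by \<open>\<pi> k\<close>. Since \<open>\<pi>\<close> is the same for the columns of one factor and
  the rows of the previous one, the relabellings cancel inside products
  (\<open>bprod_relabel\<close>), which is part (a).

  Ergodicity passes to the relabelled chain although \<open>\<pi> k\<close> need not settle down as \<open>k\<close> grows,
  because all rows of \<open>A(k:s)\<close> tend to one and the same vector (\<open>ergodic_relabel\<close>). A set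
  sequence \<open>T\<close> for \<open>B\<close> corresponds to the image sequence \<open>\<pi> k ` T k\<close> for \<open>A\<close>, with equal
  cardinalities and equal flows (\<open>trans_flow_relabel\<close>); taking \<open>T\<close> constant gives part (d).
  Finally, \<open>A\<close> arises from \<open>B\<close> through the inverse bijections, so each equivalence needs only one
  direction for arbitrary relabellings.\<close>

section \<open>Relabelling rows and columns\<close>

definition relabel :: "('m \<Rightarrow> 'm) \<Rightarrow> ('m \<Rightarrow> 'm) \<Rightarrow> 'a^'m^'m \<Rightarrow> 'a^'m^'m" where
  "relabel f g M = (\<chi> i j. M $ f i $ g j)"

lemma relabel_nth [simp]: "relabel f g M $ i $ j = M $ f i $ g j"
  by (simp add: relabel_def)

lemma relabel_inv:
  assumes "bij f" "bij g"
  shows "relabel (inv f) (inv g) (relabel f g M) = M"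
  using assms by (simp add: vec_eq_iff surj_f_inv_f bij_is_surj)

text \<open>The substitution \<open>g\<close> in the summation index leaves the sum unchanged, so the inner
  relabelling disappears.\<close>

lemma relabel_mult:
  fixes M N :: "'a::semiring_1^'m^'m"
  assumes "bij g"
  shows "relabel f g M ** relabel g h N = relabel f h (M ** N)"
proof -
  have "(\<Sum>k\<in>UNIV. M $ f i $ g k * N $ g k $ h j) = (\<Sum>k\<in>UNIV. M $ f i $ k * N $ k $ h j)" for i j
    using sum.reindex_bij_betw[OF assms, of "\<lambda>k. M $ f i $ k * N $ k $ h j"] by simp
  then show ?thesis
    by (simp add: vec_eq_iff matrix_matrix_mult_def)
qed

lemma relabel_one: "inj f \<Longrightarrow> relabel f f (mat 1) = mat 1"
  by (auto simp: vec_eq_iff mat_def inj_eq)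

lemma bprod_relabel:
  assumes "\<And>k. bij (\<pi> k)" and "s \<le> k"
  shows "bprod (\<lambda>k. relabel (\<pi> (Suc k)) (\<pi> k) (A k)) k s = relabel (\<pi> k) (\<pi> s) (bprod A k s)"
  using assms(2)
proof (induction k)
  case 0
  then show ?case using assms(1) by (simp add: relabel_one bij_is_inj)
next
  case (Suc k)
  then show ?case
    using assms(1) by (cases "s = Suc k") (auto simp: relabel_mult relabel_one bij_is_inj)
qed

lemma stochastic_matrix_relabel:
  assumes "stochastic_matrix M" "bij g"
  shows "stochastic_matrix (relabel f g M)"
proof -
  have "(\<Sum>j\<in>UNIV. M $ f i $ g j) = (\<Sum>j\<in>UNIV. M $ f i $ j)" for i
    using sum.reindex_bij_betw[OF assms(2), of "\<lambda>j. M $ f i $ j"] by simp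
  then show ?thesis
    using assms(1) by (simp add: stochastic_matrix_def)
qed

section \<open>Ergodicity\<close>

lemma rank_one_limit_iff:
  fixes X :: "nat \<Rightarrow> real^'m^'m"
  shows "X \<longlonglongrightarrow> columnvector 1 ** (rowvector v :: real^'m^1)
     \<longleftrightarrow> (\<forall>i j. (\<lambda>k. X k $ i $ j) \<longlonglongrightarrow> v $ j)"
proof -
  have *: "(columnvector 1 ** (rowvector v :: real^'m^1) :: real^'m^'m) $ i $ j = v $ j" for i j
    by (simp add: matrix_matrix_mult_def columnvector_def rowvector_def)
  show ?thesis
  proof (intro iffI allI)
    fix i j assume "X \<longlonglongrightarrow> columnvector 1 ** (rowvector v :: real^'m^1)"
    from tendsto_vec_nth[OF tendsto_vec_nth[OF this, of i], of j]
    show "(\<lambda>k. X k $ i $ j) \<longlonglongrightarrow> v $ j" by (simp only: *)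
  next
    assume "\<forall>i j. (\<lambda>k. X k $ i $ j) \<longlonglongrightarrow> v $ j"
    then show "X \<longlonglongrightarrow> columnvector 1 ** (rowvector v :: real^'m^1)"
      by (intro vec_tendstoI) (simp only: *)
  qed
qed

text \<open>If every row of a matrix sequence has the same limit, then so does any selection of rows,
  even one that changes with time: as there are finitely many rows, all of them eventually lie in
  a given neighbourhood of the limit at once.\<close>

lemma tendsto_varying_row:
  fixes X :: "nat \<Rightarrow> 'm::finite \<Rightarrow> 'a::topological_space"
  assumes "\<And>i. (\<lambda>k. X k i) \<longlonglongrightarrow> l"
  shows "(\<lambda>k. X k (r k)) \<longlonglongrightarrow> l"
proof (rule topological_tendstoI)
  fix U assume "open U" "l \<in> U"
  then have "\<forall>i. \<forall>\<^sub>F k in sequentially. X k i \<in> U"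
    using assms topological_tendstoD by blast
  then have "\<forall>\<^sub>F k in sequentially. \<forall>i. X k i \<in> U"
    by (intro eventually_all_finite) blast
  then show "\<forall>\<^sub>F k in sequentially. X k (r k) \<in> U"
    by (rule eventually_mono) blast
qed

lemma ergodic_relabel:
  assumes bij: "\<And>k. bij (\<pi> k)" and "ergodic A"
  shows "ergodic (\<lambda>k. relabel (\<pi> (Suc k)) (\<pi> k) (A k))"
  unfolding ergodic_def rank_one_limit_iff
proof
  fix s
  from \<open>ergodic A\<close> obtain v where v: "stochastic_vector v"
    and lim: "\<And>i j. (\<lambda>k. bprod A k s $ i $ j) \<longlonglongrightarrow> v $ j"
    unfolding ergodic_def rank_one_limit_iff by blast
  \<comment> \<open>Only the columns of \<open>A(k:s)\<close> are permuted by the fixed bijection \<open>\<pi> s\<close>; it permutes the limit.\<close>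
  define w where "w = (\<chi> j. v $ \<pi> s j)"
  have "stochastic_vector w"
    using v sum.reindex_bij_betw[OF bij, of "\<lambda>j. v $ j" s]
    by (simp add: w_def stochastic_vector_def)
  moreover have "(\<lambda>k. bprod (\<lambda>k. relabel (\<pi> (Suc k)) (\<pi> k) (A k)) k s $ i $ j) \<longlonglongrightarrow> w $ j" for i j
  proof (rule Lim_transform_eventually)
    show "(\<lambda>k. bprod A k s $ \<pi> k i $ \<pi> s j) \<longlonglongrightarrow> w $ j"
      unfolding w_def by (simp, rule tendsto_varying_row[OF lim])
    show "\<forall>\<^sub>F k in sequentially. bprod A k s $ \<pi> k i $ \<pi> s j =
        bprod (\<lambda>k. relabel (\<pi> (Suc k)) (\<pi> k) (A k)) k s $ i $ j"
      using eventually_ge_at_top[of s]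
      by eventually_elim (simp add: bprod_relabel[where \<pi> = \<pi>, OF bij])
  qed
  ultimately show "\<exists>v. stochastic_vector v \<and>
      (\<forall>i j. (\<lambda>k. bprod (\<lambda>k. relabel (\<pi> (Suc k)) (\<pi> k) (A k)) k s $ i $ j) \<longlonglongrightarrow> v $ j)"
    by blast
qed

section \<open>Flows\<close>

lemma trans_flow_relabel:
  assumes "bij f" "bij g"
  shows "trans_flow (relabel f g M) T' T = trans_flow M (f ` T') (g ` T)"
proof -
  have "sum h (f ` U) = (\<Sum>x\<in>U. h (f x))" "sum h (g ` U) = (\<Sum>x\<in>U. h (g x))"
    for h :: "'a \<Rightarrow> real" and U
    using assms by (simp_all add: sum.reindex inj_on_subset[OF bij_is_inj])
  then show ?thesis
    using assms by (simp add: trans_flow_def flip: bij_image_Compl_eq)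
qed

lemma cut_flow_eq_trans_flow: "cut_flow M S = trans_flow M S S"
  unfolding cut_flow_def trans_flow_def
  by (simp add: sum.distrib) (rule sum.swap)

lemma regular_image:
  assumes "\<And>k. bij (\<pi> k)" "regular T"
  shows "regular (\<lambda>k. \<pi> k ` T k)"
proof -
  have "card (\<pi> k ` T k) = card (T k)" for k
    using assms(1) by (meson bij_is_inj card_image inj_on_subset subset_UNIV)
  moreover have "\<pi> k ` T k \<subset> UNIV" for k
    using assms by (metis bij_is_inj bij_is_surj image_strict_mono regular_def)
  ultimately show ?thesis
    using assms(2) by (simp add: regular_def)
qed

lemma total_flow_cong:
  assumes "\<forall>k. trans_flow (A k) (S (k + 1)) (S k) = trans_flow (B k) (T (k + 1)) (T k)"
  shows "total_flow A S = total_flow B T"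
  using assms by (simp add: total_flow_def)

lemma absolute_infinite_flow_transfer:
  assumes "absolute_infinite_flow A"
    and "\<And>T. regular T \<Longrightarrow> \<exists>S. regular S \<and>
      (\<forall>k. trans_flow (A k) (S (k + 1)) (S k) = trans_flow (B k) (T (k + 1)) (T k))"
  shows "absolute_infinite_flow B"
  using assms total_flow_cong unfolding absolute_infinite_flow_def by metis

section \<open>Permutation matrices\<close>

definition perm_mat :: "('m \<Rightarrow> 'm) \<Rightarrow> real^'m^'m" where
  "perm_mat f = (\<chi> i j. if i = f j then 1 else 0)"

lemma permutation_matrix_perm_mat:
  assumes "permutation_matrix Q"
  obtains f where "bij f" "Q = perm_mat f"
proof
  define f where "f j = (THE i. Q $ i $ j = 1)" for j
  have row: "\<exists>!j. Q $ i $ j = 1" and col: "\<exists>!i. Q $ i $ j = 1" for i j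
    using assms by (auto simp: permutation_matrix_def)
  have f: "Q $ i $ j = 1 \<longleftrightarrow> i = f j" for i j
    using theI'[OF col[of j]] col[of j] unfolding f_def by blast
  show "bij f"
    using row unfolding f by (metis bij_iff)
  show "Q = perm_mat f"
    using assms f by (auto simp: vec_eq_iff perm_mat_def permutation_matrix_def)
qed

lemma perm_mat_mult: "perm_mat f ** perm_mat g = perm_mat (f \<circ> g)"
proof -
  have "(\<Sum>k\<in>UNIV. (if i = f k then 1 else 0) * (if k = g j then 1 else 0))
      = (\<Sum>k\<in>UNIV. if k = g j then if i = f k then 1 else 0 else (0::real))" for i j
    by (rule sum.cong) auto
  then show ?thesis
    by (simp add: perm_mat_def matrix_matrix_mult_def vec_eq_iff)
qed

lemma bprod_perm_mat:
  assumes "\<forall>k. permutation_matrix (P k)"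
  shows "\<exists>f. bij f \<and> bprod P k s = perm_mat f"
proof (induction k)
  have one: "\<exists>f. bij f \<and> mat 1 = perm_mat f"
    by (rule exI[of _ id]) (simp add: perm_mat_def mat_def)
  case 0
  show ?case using one by simp
  case (Suc k)
  then obtain f g where "bij f" "bprod P k s = perm_mat f" "bij g" "P k = perm_mat g"
    using assms permutation_matrix_perm_mat by metis
  then show ?case
    using one by (auto simp: perm_mat_mult intro: bij_comp)
qed

lemma perm_mat_conjugate: "transpose (perm_mat f) ** M ** perm_mat g = relabel f g M"
  by (simp add: vec_eq_iff matrix_matrix_mult_def transpose_def perm_mat_def
      if_distrib if_distribR cong: if_cong)

lemma perm_image_perm_mat: "perm_image (perm_mat f) S = f ` S"
  by (auto simp: perm_image_def perm_mat_def)

section \<open>The rotational transformation\<close>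

theorem lemma2:
  fixes A P B :: "nat \<Rightarrow> real^'m^'m"
  assumes "stochastic_chain A"
    and "\<forall>k. permutation_matrix (P k)"
    and "B = rotational_transformation A P"
  shows
    "(stochastic_chain B \<and>
      (\<forall>k s. s < k \<longrightarrow> bprod B k s = transpose (bprod P k 0) ** bprod A k s ** bprod P s 0)) \<and>
     (ergodic A \<longleftrightarrow> ergodic B) \<and>
     ((\<forall>S. regular S \<longrightarrow> (\<exists>T. regular T \<and>
         (\<forall>k. trans_flow (B k) (T (k + 1)) (T k) = trans_flow (A k) (S (k + 1)) (S k)))) \<and>
      (\<forall>T. regular T \<longrightarrow> (\<exists>S. regular S \<and>
         (\<forall>k. trans_flow (A k) (S (k + 1)) (S k) = trans_flow (B k) (T (k + 1)) (T k)))) \<and>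
      (\<forall>S T. regular S \<longrightarrow> regular T \<longrightarrow>
         (\<forall>k. trans_flow (A k) (S (k + 1)) (S k) = trans_flow (B k) (T (k + 1)) (T k)) \<longrightarrow>
         total_flow A S = total_flow B T) \<and>
      (absolute_infinite_flow A \<longleftrightarrow> absolute_infinite_flow B)) \<and>
     (\<forall>S k. S \<subset> UNIV \<longrightarrow>
        trans_flow (A k) (perm_image (bprod P (k + 1) 0) S) (perm_image (bprod P k 0) S)
          = cut_flow (B k) S)"
proof -
  have "\<forall>k. \<exists>f. bij f \<and> bprod P k 0 = perm_mat f"
    using bprod_perm_mat[OF assms(2)] by blast
  from choice[OF this] obtain \<pi>
    where bij: "\<And>k. bij (\<pi> k)" and P: "\<And>k. bprod P k 0 = perm_mat (\<pi> k)"
    by blast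
  \<comment> \<open>The relabelling by \<open>\<rho>\<close> leads back from \<open>B\<close> to \<open>A\<close>.\<close>
  define \<rho> where "\<rho> k = inv (\<pi> k)" for k
  have bij': "bij (\<rho> k)" for k
    using bij by (simp add: \<rho>_def bij_imp_bij_inv)
  have B: "B = (\<lambda>k. relabel (\<pi> (Suc k)) (\<pi> k) (A k))"
    unfolding assms(3) rotational_transformation_def P perm_mat_conjugate by simp
  have A: "A = (\<lambda>k. relabel (\<rho> (Suc k)) (\<rho> k) (B k))"
    unfolding B \<rho>_def by (simp add: relabel_inv bij)

  have stochastic: "stochastic_chain B"
    using assms(1) bij by (simp add: B stochastic_chain_def stochastic_matrix_relabel)
  have product: "bprod B k s = transpose (bprod P k 0) ** bprod A k s ** bprod P s 0"
    if "s < k" for k s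
    unfolding P perm_mat_conjugate B using that by (intro bprod_relabel bij) simp
  have ergodic: "ergodic A \<longleftrightarrow> ergodic B"
    using ergodic_relabel[where \<pi> = \<pi> and A = A, OF bij]
      ergodic_relabel[where \<pi> = \<rho> and A = B, OF bij']
    unfolding A[symmetric] B[symmetric] by blast

  have flow: "trans_flow (B k) T' T = trans_flow (A k) (\<pi> (Suc k) ` T') (\<pi> k ` T)" for k T' T
    unfolding B by (rule trans_flow_relabel[OF bij bij])
  have flow': "trans_flow (A k) S' S = trans_flow (B k) (\<rho> (Suc k) ` S') (\<rho> k ` S)" for k S' S
    by (subst A) (rule trans_flow_relabel[OF bij' bij'])
  have to_A: "\<exists>S. regular S \<and>
      (\<forall>k. trans_flow (A k) (S (k + 1)) (S k) = trans_flow (B k) (T (k + 1)) (T k))"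
    if "regular T" for T
    using that by (intro exI[of _ "\<lambda>k. \<pi> k ` T k"]) (simp add: flow regular_image bij)
  have to_B: "\<exists>T. regular T \<and>
      (\<forall>k. trans_flow (B k) (T (k + 1)) (T k) = trans_flow (A k) (S (k + 1)) (S k))"
    if "regular S" for S
    using that by (intro exI[of _ "\<lambda>k. \<rho> k ` S k"]) (simp add: flow' regular_image bij')
  have infinite_flow: "absolute_infinite_flow A \<longleftrightarrow> absolute_infinite_flow B"
    using absolute_infinite_flow_transfer to_A to_B by metis

  have cut: "trans_flow (A k) (perm_image (bprod P (k + 1) 0) S) (perm_image (bprod P k 0) S)
      = cut_flow (B k) S" for S k
    unfolding P perm_image_perm_mat cut_flow_eq_trans_flow flow by simp

  show ?thesis
    using stochastic product ergodic to_A to_B total_flow_cong infinite_flow cut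
    by (intro conjI allI impI) auto
qed

end
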